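(* Let $U$ be a region in the complex plane that contains $D(0,1+\delta)$ for some $\delta>0$, and let $f$ be a bounded analytic function defined on $U$. Assume that $f(z)=0$ has $h$ distinct solutions $z_1,\dots,z_h$ satisfying $|z_i|<1$, where $z_i$ has multiplicity $m_i$, and put $n:=\sum_{i=1}^h m_i$. Assume also (as may be achieved by reducing $\delta>0$) that $|z_i|<1-\delta$ for all $i$. Then for every $\varepsilon\in(0,\delta)$ there exists $N_\varepsilon$ such that if $N\ge N_\varepsilon$ then the equation $z^N=f(z)$ has $m_i$ solutions in the $\varepsilon$-neighbourhood of $z_i$ for each $i\in\{1,\dots,h\}$, no other solutions in $D(0,1-\varepsilon)$, no solutions in $U\setminus D(0,1+\varepsilon)$, and $N-n$ solutions in $\{z:1-\varepsilon<|z|<1+\varepsilon\}$, where solutions are counted with multiplicity.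
   Context: $D(w,r)=\{z\in\mathbf{C}:|z-w|\le r\}$. $N$ denotes a positive integer. A region is a connected open set. The $\varepsilon$-neighbourhood of $z_i$ is $\{z:|z-z_i|<\varepsilon\}$.
   Formalization: Exactly m_i solutions in the ε-neighbourhood of z_i is claimed only if every other z_j is farther than ε from z_i (it fails if some z_j is nearer); for all ε, disjoint subsets of the neighbourhoods hold m_i solutions each, with no other solutions in D(0,1-ε). *)

theory Defs
  imports "HOL-Complex_Analysis.Complex_Analysis"
begin

text \<open>
  The multiplicity of a solution of \<open>p z = q z\<close> is the order of vanishing of \<open>p - q\<close> there.
  Finiteness is part of the predicate because a sum over an infinite set is \<open>0\<close>. The number \<open>k\<close>
  is an integer so that a count such as \<open>int N - int n\<close> is not truncated at \<open>0\<close>.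
\<close>

definition has_solutions ::
    "(complex \<Rightarrow> complex) \<Rightarrow> (complex \<Rightarrow> complex) \<Rightarrow> complex set \<Rightarrow> int \<Rightarrow> bool" where
  "has_solutions p q A k \<longleftrightarrow>
     finite {z \<in> A. p z = q z} \<and>
     (\<Sum>z \<in> {z \<in> A. p z = q z}. zorder (\<lambda>w. p w - q w) z) = k"

end

theory Submission
  imports Defs
begin

text \<open>
  The proof compares \<open>w ^ N\<close> with \<open>f w\<close> on circles, where for large \<open>N\<close> one of the two dominates:
  on a compact subset of the open unit disc that avoids the zeros of \<open>f\<close>, the modulus of \<open>f\<close> is
  bounded below while \<open>w ^ N\<close> decays geometrically; outside a disc of radius \<open>R > 1\<close> the bounded
  function \<open>f\<close> is dwarfed by \<open>w ^ N\<close>.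

  Strict domination already excludes solutions, which settles the region \<open>cmod w > 1 + \<epsilon>\<close> and the
  part of the disc of radius \<open>1 - \<epsilon>\<close> away from the zeros. Where solutions exist they are counted by
  Rouche's theorem on a disc (\<open>has_solutions_Rouche\<close>): on a small circle around \<open>z i\<close> the
  function \<open>f\<close> dominates, so \<open>w ^ N = f w\<close> has as many solutions inside as \<open>f w = 0\<close>, that is
  \<open>m i\<close>; on the circle of radius \<open>1 + \<epsilon>\<close> the power dominates, so there are \<open>N\<close> solutions inside.

  The small discs are chosen disjoint and inside the disc of radius \<open>1 - \<epsilon>\<close>. The solutions
  in the annulus are then those in the disc of radius \<open>1 + \<epsilon>\<close> that lie in none of the small discs,
  and their number is the difference \<open>N - n\<close>.
\<close>

section \<open>Counting solutions\<close>

text \<open>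
  The two sides of an equation play the same role because negation preserves the order of a zero.
  This allows Rouche's theorem to be used with either side as the dominating one.
\<close>

lemma has_solutions_commute: "has_solutions p q A k \<longleftrightarrow> has_solutions q p A k"
proof -
  have "zorder (\<lambda>w. p w - q w) z = zorder (\<lambda>w. q w - p w) z" for z
    using Complex_Singularities.zorder_uminus[of "\<lambda>w. p w - q w" z] by simp
  moreover have "{z \<in> A. p z = q z} = {z \<in> A. q z = p z}"
    by auto
  ultimately show ?thesis
    by (simp add: has_solutions_def)
qed

lemma has_solutions_cong_set:
  assumes "{w \<in> A. p w = q w} = {w \<in> B. p w = q w}"
  shows "has_solutions p q A k \<longleftrightarrow> has_solutions p q B k"
  using assms by (simp add: has_solutions_def)

lemma has_solutions_UN_disjoint:
  assumes "finite I" and "disjoint_family_on S I"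
    and "\<And>i. i \<in> I \<Longrightarrow> has_solutions p q (S i) (k i)"
  shows "has_solutions p q (\<Union>i\<in>I. S i) (\<Sum>i\<in>I. k i)"
proof -
  let ?Z = "\<lambda>A. {w \<in> A. p w = q w}"
  have eq: "?Z (\<Union>i\<in>I. S i) = (\<Union>i\<in>I. ?Z (S i))"
    by auto
  have fin: "finite (?Z (S i))" if "i \<in> I" for i
    using assms(3)[OF that] by (simp add: has_solutions_def)
  have "(\<Sum>w\<in>(\<Union>i\<in>I. ?Z (S i)). zorder (\<lambda>w. p w - q w) w)
      = (\<Sum>i\<in>I. \<Sum>w\<in>?Z (S i). zorder (\<lambda>w. p w - q w) w)"
    using assms(1,2) fin by (intro sum.UNION_disjoint) (auto simp: disjoint_family_on_def)
  also have "\<dots> = (\<Sum>i\<in>I. k i)"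
    using assms(3) by (intro sum.cong) (auto simp: has_solutions_def)
  finally show ?thesis
    unfolding has_solutions_def eq using assms(1) fin by auto
qed

lemma has_solutions_Diff:
  assumes "has_solutions p q B k" and "has_solutions p q A j" and "A \<subseteq> B"
  shows "has_solutions p q (B - A) (k - j)"
proof -
  let ?Z = "\<lambda>A. {w \<in> A. p w = q w}"
  have "?Z (B - A) = ?Z B - ?Z A" and "?Z A \<subseteq> ?Z B"
    using assms(3) by auto
  then show ?thesis
    using assms by (simp add: has_solutions_def sum_diff)
qed

lemma zorder_power_at_0: "zorder (\<lambda>w::complex. w ^ N) 0 = int N"
  by (rule zorder_eqI[where S = UNIV and g = "\<lambda>_. 1"]) auto

lemma has_solutions_power_eq_0:
  assumes "0 < N" and "0 < R"
  shows "has_solutions (\<lambda>w. w ^ N) (\<lambda>_. 0) (ball 0 R) (int N)"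
proof -
  have "{w \<in> ball 0 R. w ^ N = (0::complex)} = {0}"
    using assms by auto
  then show ?thesis
    by (simp add: has_solutions_def zorder_power_at_0)
qed

section \<open>Rouche's theorem on a disc\<close>

lemma open_contains_larger_cball:
  fixes c :: complex
  assumes "open U" and "cball c r \<subseteq> U" and "0 < r"
  obtains R where "r < R" and "cball c R \<subseteq> U"
proof -
  obtain e where e: "0 < e" "(\<Union>x\<in>cball c r. cball x e) \<subseteq> U"
    using compact_subset_open_imp_cball_epsilon_subset[OF compact_cball assms(1,2)] by blast
  have "cball c (r + e) \<subseteq> U"
  proof
    fix w assume w: "w \<in> cball c (r + e)"
    show "w \<in> U"
    proof (cases "w \<in> cball c r")
      case True
      then show ?thesis using assms(2) by auto
    next
      case False
      then have gt: "r < dist c w" by simp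
      \<comment> \<open>the point of the small disc nearest to \<open>w\<close>\<close>
      define x where "x = c + of_real (r / dist c w) * (w - c)"
      have "dist c x = r"
        using gt assms(3) by (auto simp: x_def dist_norm norm_mult norm_divide norm_minus_commute)
      moreover have "dist x w \<le> e"
      proof -
        have "x - w = of_real (r / dist c w - 1) * (w - c)"
          by (simp add: x_def algebra_simps)
        then have "dist x w = \<bar>r / dist c w - 1\<bar> * dist c w"
          by (metis dist_norm norm_minus_commute norm_mult norm_of_real)
        also have "\<dots> = dist c w - r"
          using gt assms(3) by (cases "w = c") (auto simp: abs_if field_simps)
        finally show ?thesis using w by simp
      qed
      ultimately show ?thesis using e(2) by force
    qed
  qed
  with e(1) show ?thesis by (intro that[of "r + e"]) auto
qed

text \<open>
  Infinitely many zeros would accumulate in the compact disc, and \<open>f\<close> would vanish identically on a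
  larger one, the bounding circle included.
\<close>

lemma holomorphic_finite_zeros_cball:
  assumes "f holomorphic_on U" and "open U" and "cball c r \<subseteq> U" and "0 < r"
    and "\<And>w. w \<in> sphere c r \<Longrightarrow> f w \<noteq> 0"
  shows "finite {w \<in> cball c r. f w = 0}"
proof -
  obtain R where R: "r < R" "cball c R \<subseteq> U"
    using open_contains_larger_cball[OF assms(2,3,4)] .
  have sub: "cball c r \<subseteq> ball c R"
    using R(1) by auto
  have holo: "f holomorphic_on ball c R"
    using assms(1) R(2) by (meson ball_subset_cball holomorphic_on_subset order_trans)
  have p: "c + of_real r \<in> sphere c r"
    using assms(4) by (simp add: dist_norm)
  show ?thesis
  proof (cases "f constant_on ball c R")
    case True
    then obtain k where k: "\<And>w. w \<in> ball c R \<Longrightarrow> f w = k"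
      unfolding constant_on_def by blast
    have "k \<noteq> 0"
      using k[of "c + of_real r"] assms(5)[OF p] p R(1) by auto
    then have "{w \<in> cball c r. f w = 0} = {}"
      using k sub by auto
    then show ?thesis by (metis finite.emptyI)
  next
    case False
    then show ?thesis
      using holomorphic_compact_finite_zeros[OF holo open_ball connected_ball compact_cball sub]
      by blast
  qed
qed

text \<open>
  Rouche's theorem for contours needs a neighbourhood of the disc with finitely many zeros, each
  weighted by its winding number. Domination on the circle is an open condition, so it persists on
  a thin annulus outside the disc and excludes zeros there. In a slightly larger disc all zeros
  therefore lie in the original one and have winding number \<open>1\<close>.
\<close>

lemma has_solutions_Rouche:
  assumes holo: "p holomorphic_on U" "q holomorphic_on U" and U: "open U" "cball c r \<subseteq> U"
    and r: "0 < r"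
    and dom: "\<And>w. w \<in> sphere c r \<Longrightarrow> cmod (q w) < cmod (p w)"
    and p0: "has_solutions p (\<lambda>_. 0) (ball c r) k"
  shows "has_solutions p q (ball c r) k"
proof -
  let ?V = "{w \<in> U. cmod (q w) < cmod (p w)} \<union> ball c r"
  have "open {w \<in> U. cmod (q w) < cmod (p w)}"
  proof -
    have "continuous_on U (\<lambda>w. cmod (p w) - cmod (q w))"
      using holo by (intro continuous_intros holomorphic_on_imp_continuous_on)
    then have "open (U \<inter> (\<lambda>w. cmod (p w) - cmod (q w)) -` {0<..})"
      using U(1) by (intro continuous_open_preimage) auto
    moreover have "U \<inter> (\<lambda>w. cmod (p w) - cmod (q w)) -` {0<..} = {w \<in> U. cmod (q w) < cmod (p w)}"
      by auto
    ultimately show ?thesis by simp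
  qed
  then have "open ?V" by auto
  moreover have "cball c r \<subseteq> ?V"
    using U(2) dom by (force simp: less_le)
  ultimately obtain R where R: "r < R" "cball c R \<subseteq> ?V"
    using open_contains_larger_cball r by blast
  have sub: "ball c R \<subseteq> U"
    using R(2) U(2) ball_subset_cball[of c R] ball_subset_cball[of c r] by blast
  have holo': "p holomorphic_on ball c R" "(\<lambda>w. - q w) holomorphic_on ball c R"
    using holo sub by (auto intro!: holomorphic_intros intro: holomorphic_on_subset)
  have no_zeros: "w \<in> ball c r" if "w \<in> ball c R" "p w = 0 \<or> p w + - q w = 0" for w
  proof -
    have "\<not> cmod (q w) < cmod (p w)"
      using that(2) by auto
    then show ?thesis
      using R(2) that(1) ball_subset_cball[of c R] by blast
  qed
  have zeros_p: "{w \<in> ball c R. p w = 0} = {w \<in> ball c r. p w = 0}"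
    and zeros_pq: "{w \<in> ball c R. p w + - q w = 0} = {w \<in> ball c r. p w = q w}"
    using no_zeros R(1) by auto
  have fin_p: "finite {w \<in> ball c r. p w = 0}"
    using p0 by (simp add: has_solutions_def)
  have fin_pq: "finite {w \<in> ball c r. p w = q w}"
  proof -
    have "(\<lambda>w. p w - q w) holomorphic_on U"
      using holo by (intro holomorphic_intros)
    moreover have "p w - q w \<noteq> 0" if "w \<in> sphere c r" for w
      using dom[OF that] by auto
    ultimately have "finite {w \<in> cball c r. p w - q w = 0}"
      by (intro holomorphic_finite_zeros_cball[of _ U] U r)
    then show ?thesis by (rule finite_subset[rotated]) auto
  qed
  have wind: "winding_number (circlepath c r) w = 1" if "w \<in> ball c r" for w
    using that by (intro winding_number_circlepath) (simp add: dist_norm norm_minus_commute)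
  have "(\<Sum>w\<in>{w \<in> ball c R. p w + - q w = 0}.
          winding_number (circlepath c r) w * zorder (\<lambda>w. p w + - q w) w)
      = (\<Sum>w\<in>{w \<in> ball c R. p w = 0}. winding_number (circlepath c r) w * zorder p w)"
  proof (rule Rouche_theorem)
    show "\<forall>w. w \<notin> ball c R \<longrightarrow> winding_number (circlepath c r) w = 0"
    proof (intro allI impI)
      fix w assume "w \<notin> ball c R"
      then have w: "w \<notin> cball c r" using R(1) by auto
      show "winding_number (circlepath c r) w = 0"
        by (rule winding_number_zero_outside[of _ "cball c r"]) (use w r in auto)
    qed
  qed (use holo' fin_p fin_pq zeros_p zeros_pq R(1) r dom in auto)
  also have "(\<Sum>w\<in>{w \<in> ball c R. p w = 0}. winding_number (circlepath c r) w * zorder p w)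
      = of_int (\<Sum>w\<in>{w \<in> ball c r. p w = 0}. zorder p w)"
    unfolding zeros_p of_int_sum by (intro sum.cong) (auto simp: wind)
  also have "(\<Sum>w\<in>{w \<in> ball c R. p w + - q w = 0}.
          winding_number (circlepath c r) w * zorder (\<lambda>w. p w + - q w) w)
      = of_int (\<Sum>w\<in>{w \<in> ball c r. p w = q w}. zorder (\<lambda>w. p w - q w) w)"
    unfolding zeros_pq of_int_sum by (intro sum.cong) (auto simp: wind)
  finally have "(\<Sum>w\<in>{w \<in> ball c r. p w = q w}. zorder (\<lambda>w. p w - q w) w)
      = (\<Sum>w\<in>{w \<in> ball c r. p w = 0}. zorder p w)"
    unfolding of_int_eq_iff .
  then show ?thesis
    using p0 fin_pq by (simp add: has_solutions_def)
qed

section \<open>Domination for large exponents\<close>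

lemma eventually_power_less_on_compact:
  fixes f :: "complex \<Rightarrow> complex"
  assumes "compact K" and "K \<subseteq> ball 0 1" and "continuous_on K f"
    and "\<And>w. w \<in> K \<Longrightarrow> f w \<noteq> 0"
  shows "eventually (\<lambda>N. \<forall>w\<in>K. cmod (w ^ N) < cmod (f w)) sequentially"
proof (cases "K = {}")
  case False
  obtain a where a: "a \<in> K" "\<And>w. w \<in> K \<Longrightarrow> cmod (f a) \<le> cmod (f w)"
    using continuous_attains_inf[OF assms(1) False continuous_on_norm[OF assms(3)]] by blast
  obtain b where b: "b \<in> K" "\<And>w. w \<in> K \<Longrightarrow> cmod w \<le> cmod b"
    using continuous_attains_sup[OF assms(1) False continuous_on_norm[OF continuous_on_id]] by blast
  have "cmod b < 1" and "0 < cmod (f a)"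
    using a(1) b(1) assms(2,4) by auto
  then have "(\<lambda>N. cmod b ^ N) \<longlonglongrightarrow> 0"
    by (intro LIMSEQ_realpow_zero) auto
  then have "eventually (\<lambda>N. cmod b ^ N < cmod (f a)) sequentially"
    using \<open>0 < cmod (f a)\<close> by (rule order_tendstoD)
  then show ?thesis
  proof eventually_elim
    case (elim N)
    show ?case
    proof
      fix w assume w: "w \<in> K"
      have "cmod (w ^ N) \<le> cmod b ^ N"
        using b(2)[OF w] by (simp add: norm_power power_mono)
      also note elim
      also have "cmod (f a) \<le> cmod (f w)"
        using a(2)[OF w] .
      finally show "cmod (w ^ N) < cmod (f w)" .
    qed
  qed
qed simp

lemma eventually_power_greater_outside_disc:
  fixes f :: "complex \<Rightarrow> complex"
  assumes "bounded (f ` U)" and "1 < R"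
  shows "eventually (\<lambda>N. \<forall>w\<in>U. R \<le> cmod w \<longrightarrow> cmod (f w) < cmod (w ^ N)) sequentially"
proof -
  obtain B where B: "\<And>w. w \<in> U \<Longrightarrow> cmod (f w) \<le> B"
    using assms(1) by (auto simp: bounded_iff)
  obtain M where M: "B < R ^ M"
    using real_arch_pow[OF assms(2)] by blast
  have "eventually (\<lambda>N. B < R ^ N) sequentially"
    using eventually_ge_at_top[of M]
  proof eventually_elim
    case (elim N)
    with M show ?case
      using power_increasing[of M N R] assms(2) by linarith
  qed
  then show ?thesis
  proof eventually_elim
    case (elim N)
    show ?case
    proof (intro ballI impI)
      fix w assume w: "w \<in> U" "R \<le> cmod w"
      have "cmod (f w) \<le> B" using B[OF w(1)] .
      also note elim
      also have "R ^ N \<le> cmod (w ^ N)"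
        using w(2) assms(2) by (simp add: norm_power power_mono)
      finally show "cmod (f w) < cmod (w ^ N)" .
    qed
  qed
qed

text \<open>
  On the circle \<open>f\<close> is the dominating function, so the solutions in the disc are counted by the zeros
  of \<open>f\<close> there, of which \<open>c\<close> is the only one.
\<close>

lemma eventually_has_solutions_power_near_zero:
  assumes "f holomorphic_on U" and "open U" and "cball c r \<subseteq> U" and "cball c r \<subseteq> ball 0 1"
    and "0 < r" and zero: "{w \<in> cball c r. f w = 0} = {c}"
  shows "eventually (\<lambda>N. has_solutions (\<lambda>w. w ^ N) f (ball c r) (zorder f c)) sequentially"
proof -
  have "continuous_on (sphere c r) f"
    using assms(1,3) sphere_cball[of c r]
    by (meson continuous_on_subset holomorphic_on_imp_continuous_on order_trans)
  moreover have "f w \<noteq> 0" if "w \<in> sphere c r" for w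
    using zero that assms(5) by auto
  moreover have "sphere c r \<subseteq> ball 0 1"
    using assms(4) sphere_cball[of c r] by blast
  ultimately have dom: "eventually (\<lambda>N. \<forall>w\<in>sphere c r. cmod (w ^ N) < cmod (f w)) sequentially"
    by (intro eventually_power_less_on_compact) auto
  have "{w \<in> ball c r. f w = 0} = {w \<in> cball c r. f w = 0} \<inter> ball c r"
    by auto
  then have "{w \<in> ball c r. f w = 0} = {c}"
    unfolding zero using assms(5) by simp
  then have count_f: "has_solutions f (\<lambda>_. 0) (ball c r) (zorder f c)"
    by (simp add: has_solutions_def)
  from dom show ?thesis
  proof eventually_elim
    case (elim N)
    have "(\<lambda>w. w ^ N) holomorphic_on U"
      by (intro holomorphic_intros)
    then have "has_solutions f (\<lambda>w. w ^ N) (ball c r) (zorder f c)"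
      using has_solutions_Rouche[OF assms(1) _ assms(2,3,5) _ count_f] elim by blast
    then show ?case by (rule has_solutions_commute[THEN iffD1])
  qed
qed

text \<open>
  Here the power dominates on the circle, and the zeros counted are those of \<open>w ^ N\<close>: the origin, with
  multiplicity \<open>N\<close>.
\<close>

lemma eventually_has_solutions_power_disc:
  assumes "f holomorphic_on U" and "open U" and "cball 0 R \<subseteq> U" and "bounded (f ` U)" and "1 < R"
  shows "eventually (\<lambda>N. has_solutions (\<lambda>w. w ^ N) f (ball 0 R) (int N)) sequentially"
  using eventually_power_greater_outside_disc[OF assms(4,5)] eventually_gt_at_top[of 0]
proof eventually_elim
  case (elim N)
  have "cmod (f w) < cmod (w ^ N)" if "w \<in> sphere 0 R" for w
    using elim(1) that assms(3) by (auto simp: subset_iff)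
  moreover have "has_solutions (\<lambda>w. w ^ N) (\<lambda>_. 0) (ball 0 R) (int N)"
    using elim(2) assms(5) by (intro has_solutions_power_eq_0) auto
  moreover have "(\<lambda>w. w ^ N) holomorphic_on U"
    by (intro holomorphic_intros)
  ultimately show ?case
    using has_solutions_Rouche[OF _ assms(1,2,3)] assms(5) by simp
qed

section \<open>Solutions near the zeros and near the unit circle\<close>

lemma finite_inj_family_separated:
  fixes z :: "'i \<Rightarrow> 'a :: metric_space"
  assumes "finite I" and "inj_on z I"
  obtains d where "0 < d" and "\<And>i j. i \<in> I \<Longrightarrow> j \<in> I \<Longrightarrow> i \<noteq> j \<Longrightarrow> 2 * d \<le> dist (z i) (z j)"
proof -
  let ?D = "insert 1 ((\<lambda>(i, j). dist (z i) (z j)) ` {(i, j) \<in> I \<times> I. i \<noteq> j})"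
  have fin: "finite ?D"
    using assms(1) by (auto intro: finite_subset[of _ "I \<times> I"])
  have "0 < Min ?D"
    using fin assms(2) by (subst Min_gr_iff) (auto dest: inj_onD)
  moreover have "Min ?D \<le> dist (z i) (z j)" if "i \<in> I" "j \<in> I" "i \<noteq> j" for i j
    using fin that by (intro Min_le) auto
  ultimately show ?thesis
    by (intro that[of "Min ?D / 2"]) auto
qed

theorem theorem12:
  fixes U :: "complex set" and f :: "complex \<Rightarrow> complex" and \<delta> :: real
    and h n :: nat and z :: "nat \<Rightarrow> complex" and m :: "nat \<Rightarrow> nat"
  assumes "open U" and "connected U"
    and "\<delta> > 0" and "cball 0 (1 + \<delta>) \<subseteq> U"
    and "f analytic_on U" and "bounded (f ` U)"
    and "inj_on z {1..h}"
    and "z ` {1..h} = {w \<in> U. f w = 0 \<and> cmod w < 1}"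
    and "\<And>i. i \<in> {1..h} \<Longrightarrow> zorder f (z i) = int (m i)"
    and "n = (\<Sum>i=1..h. m i)"
    and "\<And>i. i \<in> {1..h} \<Longrightarrow> cmod (z i) < 1 - \<delta>"
  shows "\<forall>\<epsilon>. 0 < \<epsilon> \<and> \<epsilon> < \<delta> \<longrightarrow>
    (\<exists>N\<^sub>\<epsilon>::nat. \<forall>N::nat. 0 < N \<and> N\<^sub>\<epsilon> \<le> N \<longrightarrow>
      (\<forall>i\<in>{1..h}. (\<forall>j\<in>{1..h}. j \<noteq> i \<longrightarrow> \<epsilon> < dist (z i) (z j)) \<longrightarrow>
         has_solutions (\<lambda>w. w ^ N) f (ball (z i) \<epsilon>) (int (m i))) \<and>
      (\<exists>S :: nat \<Rightarrow> complex set.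
         disjoint_family_on S {1..h} \<and>
         (\<forall>i\<in>{1..h}. S i \<subseteq> ball (z i) \<epsilon> \<and>
            has_solutions (\<lambda>w. w ^ N) f (S i) (int (m i))) \<and>
         (\<forall>w \<in> cball 0 (1 - \<epsilon>) - (\<Union>i\<in>{1..h}. S i). w ^ N \<noteq> f w)) \<and>
      (\<forall>w \<in> U - cball 0 (1 + \<epsilon>). w ^ N \<noteq> f w) \<and>
      has_solutions (\<lambda>w. w ^ N) f {w. 1 - \<epsilon> < cmod w \<and> cmod w < 1 + \<epsilon>} (int N - int n))"
proof (intro allI impI)
  fix \<epsilon> :: real
  assume "0 < \<epsilon> \<and> \<epsilon> < \<delta>"
  then have eps: "0 < \<epsilon>" "\<epsilon> < \<delta>" by auto
  let ?I = "{1..h}"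
  have holo: "f holomorphic_on U"
    using assms(5) by (rule analytic_imp_holomorphic)
  have zeros: "\<exists>j\<in>?I. w = z j" if "cmod w < 1" "f w = 0" for w
  proof -
    have "w \<in> U" using that(1) assms(3,4) by auto
    then have "w \<in> z ` ?I" unfolding assms(8) using that by simp
    then show ?thesis by auto
  qed
  have z_zero: "f (z i) = 0" if "i \<in> ?I" for i
    using assms(8) that by blast
  have unit_disc: "ball 0 1 \<subseteq> U"
    using assms(3,4) by auto
  \<comment> \<open>Since \<open>\<epsilon> < \<delta>\<close>, discs around the zeros of radius at most \<open>\<epsilon>\<close> stay inside the unit disc.\<close>
  have near: "cball (z i) r \<subseteq> ball 0 1" if "i \<in> ?I" "r \<le> \<epsilon>" for i r
  proof
    fix w assume "w \<in> cball (z i) r"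
    then have "dist 0 w \<le> cmod (z i) + r"
      using dist_triangle[of 0 w "z i"] by auto
    then show "w \<in> ball 0 1"
      using assms(11)[OF that(1)] that(2) eps(2) by simp
  qed
  have local_count: "eventually (\<lambda>N. has_solutions (\<lambda>w. w ^ N) f (ball (z i) r) (int (m i))) sequentially"
    if i: "i \<in> ?I" and r: "0 < r" "r \<le> \<epsilon>" and sep: "\<And>j. j \<in> ?I \<Longrightarrow> j \<noteq> i \<Longrightarrow> r < dist (z i) (z j)"
    for i r
  proof -
    have "{w \<in> cball (z i) r. f w = 0} = {z i}"
    proof (intro equalityI subsetI)
      fix w assume w: "w \<in> {w \<in> cball (z i) r. f w = 0}"
      then have "cmod w < 1" using near[OF i r(2)] by auto
      then obtain j where "j \<in> ?I" "w = z j" using zeros[of w] w by blast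
      then show "w \<in> {z i}" using sep[of j] w by (cases "j = i") auto
    qed (use z_zero[OF i] r in auto)
    then show ?thesis
      using eventually_has_solutions_power_near_zero[OF holo assms(1), of "z i" r]
        near[OF i r(2)] unit_disc r(1) assms(9)[OF i] by auto
  qed

  obtain d where d: "0 < d" "\<And>i j. i \<in> ?I \<Longrightarrow> j \<in> ?I \<Longrightarrow> i \<noteq> j \<Longrightarrow> 2 * d \<le> dist (z i) (z j)"
    using finite_inj_family_separated[OF finite_atLeastAtMost assms(7)] by blast
  \<comment> \<open>The bound \<open>\<delta> - \<epsilon>\<close> keeps the discs inside the disc of radius \<open>1 - \<epsilon>\<close>, away from the annulus.\<close>
  define \<rho> where "\<rho> = min d (min \<epsilon> (\<delta> - \<epsilon>))"
  define S where "S = (\<lambda>i. ball (z i) \<rho>)"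
  have rho: "0 < \<rho>" "\<rho> \<le> d" "\<rho> \<le> \<epsilon>" "\<rho> \<le> \<delta> - \<epsilon>"
    using d(1) eps by (auto simp: \<rho>_def)
  have disj: "disjoint_family_on S ?I"
    unfolding disjoint_family_on_def
  proof (intro ballI impI)
    fix i j assume ij: "i \<in> ?I" "j \<in> ?I" "i \<noteq> j"
    have "\<rho> + \<rho> \<le> dist (z i) (z j)" using d(2)[OF ij] rho(2) by simp
    then show "S i \<inter> S j = {}" unfolding S_def by (rule disjoint_ballI)
  qed
  have S_inner: "S i \<subseteq> cball 0 (1 - \<epsilon>)" if "i \<in> ?I" for i
  proof
    fix w assume "w \<in> S i"
    then have "dist 0 w \<le> cmod (z i) + \<rho>"
      using dist_triangle[of 0 w "z i"] by (auto simp: S_def)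
    then show "w \<in> cball 0 (1 - \<epsilon>)"
      using assms(11)[OF that] rho(4) by simp
  qed
  let ?K = "cball 0 (1 - \<epsilon>) - (\<Union>i\<in>?I. S i)"

  have ev_eps: "eventually (\<lambda>N. \<forall>i\<in>?I. (\<forall>j\<in>?I. j \<noteq> i \<longrightarrow> \<epsilon> < dist (z i) (z j)) \<longrightarrow>
      has_solutions (\<lambda>w. w ^ N) f (ball (z i) \<epsilon>) (int (m i))) sequentially"
  proof (intro eventually_ball_finite finite_atLeastAtMost ballI)
    fix i assume "i \<in> ?I"
    then show "eventually (\<lambda>N. (\<forall>j\<in>?I. j \<noteq> i \<longrightarrow> \<epsilon> < dist (z i) (z j)) \<longrightarrow>
        has_solutions (\<lambda>w. w ^ N) f (ball (z i) \<epsilon>) (int (m i))) sequentially"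
      using local_count[of i \<epsilon>] eps(1)
      by (cases "\<forall>j\<in>?I. j \<noteq> i \<longrightarrow> \<epsilon> < dist (z i) (z j)") auto
  qed
  have ev_S: "eventually (\<lambda>N. \<forall>i\<in>?I. has_solutions (\<lambda>w. w ^ N) f (S i) (int (m i))) sequentially"
  proof (intro eventually_ball_finite finite_atLeastAtMost ballI)
    fix i assume i: "i \<in> ?I"
    have "\<rho> < dist (z i) (z j)" if "j \<in> ?I" "j \<noteq> i" for j
      using d(2)[of i j] i that rho by auto
    then show "eventually (\<lambda>N. has_solutions (\<lambda>w. w ^ N) f (S i) (int (m i))) sequentially"
      unfolding S_def using local_count[of i \<rho>] i rho by blast
  qed
  have ev_K: "eventually (\<lambda>N. \<forall>w\<in>?K. cmod (w ^ N) < cmod (f w)) sequentially"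
  proof (rule eventually_power_less_on_compact)
    show "compact ?K"
      by (intro compact_diff compact_cball) (auto simp: S_def)
    show sub: "?K \<subseteq> ball 0 1" using eps(1) by auto
    show "continuous_on ?K f"
      using holo sub unit_disc
      by (meson continuous_on_subset holomorphic_on_imp_continuous_on order_trans)
    show "f w \<noteq> 0" if "w \<in> ?K" for w
    proof
      assume "f w = 0"
      moreover have "cmod w < 1" using sub that by auto
      ultimately obtain j where j: "j \<in> ?I" "w = z j" using zeros by blast
      then have "w \<in> S j" using rho(1) by (simp add: S_def)
      then show False using that j(1) by blast
    qed
  qed
  have ev_out: "eventually (\<lambda>N. \<forall>w\<in>U. 1 + \<epsilon> \<le> cmod w \<longrightarrow> cmod (f w) < cmod (w ^ N)) sequentially"
    using eps(1) by (intro eventually_power_greater_outside_disc assms(6)) auto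
  have ev_disc: "eventually (\<lambda>N. has_solutions (\<lambda>w. w ^ N) f (ball 0 (1 + \<epsilon>)) (int N)) sequentially"
    using eps assms(4)
    by (intro eventually_has_solutions_power_disc[OF holo assms(1)] assms(6)) auto
  obtain N\<^sub>0 where N0: "\<And>N. N\<^sub>0 \<le> N \<Longrightarrow>
      (\<forall>i\<in>?I. (\<forall>j\<in>?I. j \<noteq> i \<longrightarrow> \<epsilon> < dist (z i) (z j)) \<longrightarrow>
        has_solutions (\<lambda>w. w ^ N) f (ball (z i) \<epsilon>) (int (m i))) \<and>
      (\<forall>i\<in>?I. has_solutions (\<lambda>w. w ^ N) f (S i) (int (m i))) \<and>
      (\<forall>w\<in>?K. cmod (w ^ N) < cmod (f w)) \<and>
      (\<forall>w\<in>U. 1 + \<epsilon> \<le> cmod w \<longrightarrow> cmod (f w) < cmod (w ^ N)) \<and>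
      has_solutions (\<lambda>w. w ^ N) f (ball 0 (1 + \<epsilon>)) (int N)"
    using eventually_conj[OF ev_eps eventually_conj[OF ev_S eventually_conj[OF ev_K
      eventually_conj[OF ev_out ev_disc]]]]
    unfolding eventually_sequentially by blast

  show "\<exists>N\<^sub>\<epsilon>::nat. \<forall>N::nat. 0 < N \<and> N\<^sub>\<epsilon> \<le> N \<longrightarrow>
      (\<forall>i\<in>{1..h}. (\<forall>j\<in>{1..h}. j \<noteq> i \<longrightarrow> \<epsilon> < dist (z i) (z j)) \<longrightarrow>
         has_solutions (\<lambda>w. w ^ N) f (ball (z i) \<epsilon>) (int (m i))) \<and>
      (\<exists>S :: nat \<Rightarrow> complex set.
         disjoint_family_on S {1..h} \<and>
         (\<forall>i\<in>{1..h}. S i \<subseteq> ball (z i) \<epsilon> \<and>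
            has_solutions (\<lambda>w. w ^ N) f (S i) (int (m i))) \<and>
         (\<forall>w \<in> cball 0 (1 - \<epsilon>) - (\<Union>i\<in>{1..h}. S i). w ^ N \<noteq> f w)) \<and>
      (\<forall>w \<in> U - cball 0 (1 + \<epsilon>). w ^ N \<noteq> f w) \<and>
      has_solutions (\<lambda>w. w ^ N) f {w. 1 - \<epsilon> < cmod w \<and> cmod w < 1 + \<epsilon>} (int N - int n)"
  proof (intro exI[of _ N\<^sub>0] allI impI)
    fix N :: nat assume "0 < N \<and> N\<^sub>0 \<le> N"
    then have N: "\<And>i. i \<in> ?I \<Longrightarrow> (\<forall>j\<in>?I. j \<noteq> i \<longrightarrow> \<epsilon> < dist (z i) (z j)) \<Longrightarrow>
          has_solutions (\<lambda>w. w ^ N) f (ball (z i) \<epsilon>) (int (m i))"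
        "\<And>i. i \<in> ?I \<Longrightarrow> has_solutions (\<lambda>w. w ^ N) f (S i) (int (m i))"
        "\<And>w. w \<in> ?K \<Longrightarrow> cmod (w ^ N) < cmod (f w)"
        "\<And>w. w \<in> U \<Longrightarrow> 1 + \<epsilon> \<le> cmod w \<Longrightarrow> cmod (f w) < cmod (w ^ N)"
        "has_solutions (\<lambda>w. w ^ N) f (ball 0 (1 + \<epsilon>)) (int N)"
      using N0[of N] by blast+
    have K: "w ^ N \<noteq> f w" if "w \<in> ?K" for w
      using N(3)[OF that] by auto
    have out: "w ^ N \<noteq> f w" if "w \<in> U - cball 0 (1 + \<epsilon>)" for w
      using N(4)[of w] that by auto
    have S_eps: "S i \<subseteq> ball (z i) \<epsilon>" for i
      using rho(3) by (auto simp: S_def)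
    have "has_solutions (\<lambda>w. w ^ N) f (\<Union>i\<in>?I. S i) (\<Sum>i\<in>?I. int (m i))"
      using N(2) disj by (intro has_solutions_UN_disjoint) auto
    moreover have "(\<Union>i\<in>?I. S i) \<subseteq> ball 0 (1 + \<epsilon>)"
      using S_inner eps(1) by fastforce
    ultimately have diff: "has_solutions (\<lambda>w. w ^ N) f (ball 0 (1 + \<epsilon>) - (\<Union>i\<in>?I. S i)) (int N - int n)"
      using has_solutions_Diff[OF N(5)] assms(10) by simp
    have "{w \<in> ball 0 (1 + \<epsilon>) - (\<Union>i\<in>?I. S i). w ^ N = f w}
        = {w \<in> {w. 1 - \<epsilon> < cmod w \<and> cmod w < 1 + \<epsilon>}. w ^ N = f w}"
    proof (intro equalityI subsetI)
      fix w assume "w \<in> {w \<in> ball 0 (1 + \<epsilon>) - (\<Union>i\<in>?I. S i). w ^ N = f w}"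
      then show "w \<in> {w \<in> {w. 1 - \<epsilon> < cmod w \<and> cmod w < 1 + \<epsilon>}. w ^ N = f w}"
        using K[of w] by (cases "cmod w \<le> 1 - \<epsilon>") auto
    next
      fix w assume "w \<in> {w \<in> {w. 1 - \<epsilon> < cmod w \<and> cmod w < 1 + \<epsilon>}. w ^ N = f w}"
      then show "w \<in> {w \<in> ball 0 (1 + \<epsilon>) - (\<Union>i\<in>?I. S i). w ^ N = f w}"
        using S_inner by fastforce
    qed
    from has_solutions_cong_set[OF this] diff have annulus:
      "has_solutions (\<lambda>w. w ^ N) f {w. 1 - \<epsilon> < cmod w \<and> cmod w < 1 + \<epsilon>} (int N - int n)"
      by (rule iffD1)
    have small: "\<exists>S :: nat \<Rightarrow> complex set. disjoint_family_on S ?I \<and>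
         (\<forall>i\<in>?I. S i \<subseteq> ball (z i) \<epsilon> \<and> has_solutions (\<lambda>w. w ^ N) f (S i) (int (m i))) \<and>
         (\<forall>w \<in> cball 0 (1 - \<epsilon>) - (\<Union>i\<in>?I. S i). w ^ N \<noteq> f w)"
      using disj S_eps N(2) K by (intro exI[of _ S] conjI ballI)
    show "(\<forall>i\<in>{1..h}. (\<forall>j\<in>{1..h}. j \<noteq> i \<longrightarrow> \<epsilon> < dist (z i) (z j)) \<longrightarrow>
         has_solutions (\<lambda>w. w ^ N) f (ball (z i) \<epsilon>) (int (m i))) \<and>
      (\<exists>S :: nat \<Rightarrow> complex set.
         disjoint_family_on S {1..h} \<and>
         (\<forall>i\<in>{1..h}. S i \<subseteq> ball (z i) \<epsilon> \<and>
            has_solutions (\<lambda>w. w ^ N) f (S i) (int (m i))) \<and>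
         (\<forall>w \<in> cball 0 (1 - \<epsilon>) - (\<Union>i\<in>{1..h}. S i). w ^ N \<noteq> f w)) \<and>
      (\<forall>w \<in> U - cball 0 (1 + \<epsilon>). w ^ N \<noteq> f w) \<and>
      has_solutions (\<lambda>w. w ^ N) f {w. 1 - \<epsilon> < cmod w \<and> cmod w < 1 + \<epsilon>} (int N - int n)"
      using N(1) out by (intro conjI ballI impI small annulus)
  qed
qed

end
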